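(* Every extended LTL formula $\varphi$ is equivalent to a formula in normal form with at most $4^{7|\varphi|}$ nodes.
   Context: Extended LTL formulas over a finite set $Ap$: $\varphi ::= \mathbf{tt}\mid\mathbf{ff}\mid a\mid\overline a\mid\varphi\wedge\varphi\mid\varphi\vee\varphi\mid\mathbf X\varphi\mid\varphi\,\mathbf U\,\varphi\mid\varphi\,\mathbf W\,\varphi\mid\mathbf{GF}\varphi\mid\mathbf{FG}\varphi$ ($a\in Ap$), interpreted on infinite words $w$ over $2^{Ap}$ ($w_i$ = suffix from position $i$): $w\models a$ iff $a\in w[0]$, $w\models\overline a$ iff $a\notin w[0]$, $\wedge,\vee$ as usual, $w\models\mathbf X\varphi$ iff $w_1\models\varphi$, $w\models\varphi\mathbf U\psi$ iff $\exists k.\,w_k\models\psi\wedge\forall j<k.\,w_j\models\varphi$, $w\models\varphi\mathbf W\psi$ iff $\forall k.\,w_k\models\varphi$ or $w\models\varphi\mathbf U\psi$, $w\models\mathbf{GF}\varphi$ iff $w_i\models\varphi$ for infinitely many $i$, $w\models\mathbf{FG}\varphi$ iff $w_i\models\varphi$ for all but finitely many $i$. $\mathbf{GF}$ and $\mathbf{FG}$ are single (atomic) operators. $|\varphi|$ is the number of nodes of the syntax tree $T_\varphi$. A node is a $\mathbf U$-node ($\mathbf W$-, $\mathbf X$-, $\mathbf{GF}$-, $\mathbf{FG}$-node) if the subformula rooted at it has that top operator; temporal nodes are $\mathbf U,\mathbf W,\mathbf X,\mathbf{GF},\mathbf{FG}$-nodes; limit nodes are $\mathbf{GF}$- and $\mathbf{FG}$-nodes.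 "Under" means being a proper descendant. A formula is in normal form if (1) no $\mathbf U$-node is under a $\mathbf W$-node; (2) no limit node is under another temporal node; (3) no $\mathbf W$-node is under a $\mathbf{GF}$-node and no $\mathbf U$-node is under an $\mathbf{FG}$-node. *)

theory Defs
  imports "HOL-Library.Sublist" "HOL-Library.Omega_Words_Fun"
begin

datatype (discs_sels) (atoms: 'a) ltl =
    LTrue
  | LFalse
  | Prop 'a
  | NProp 'a
  | And "'a ltl" "'a ltl"
  | Or "'a ltl" "'a ltl"
  | Next "'a ltl"
  | Until "'a ltl" "'a ltl"
  | WeakUntil "'a ltl" "'a ltl"
  | GF "'a ltl"
  | FG "'a ltl"

primrec sat :: "'a set word \<Rightarrow> 'a ltl \<Rightarrow> bool" (infix "\<Turnstile>" 50) where
  "w \<Turnstile> LTrue \<longleftrightarrow> True"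
| "w \<Turnstile> LFalse \<longleftrightarrow> False"
| "w \<Turnstile> Prop a \<longleftrightarrow> a \<in> w 0"
| "w \<Turnstile> NProp a \<longleftrightarrow> a \<notin> w 0"
| "w \<Turnstile> And \<phi> \<psi> \<longleftrightarrow> w \<Turnstile> \<phi> \<and> w \<Turnstile> \<psi>"
| "w \<Turnstile> Or \<phi> \<psi> \<longleftrightarrow> w \<Turnstile> \<phi> \<or> w \<Turnstile> \<psi>"
| "w \<Turnstile> Next \<phi> \<longleftrightarrow> suffix 1 w \<Turnstile> \<phi>"
| "w \<Turnstile> Until \<phi> \<psi> \<longleftrightarrow> (\<exists>k. suffix k w \<Turnstile> \<psi> \<and> (\<forall>j<k. suffix j w \<Turnstile> \<phi>))"
| "w \<Turnstile> WeakUntil \<phi> \<psi> \<longleftrightarrow>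
     (\<forall>k. suffix k w \<Turnstile> \<phi>) \<or> (\<exists>k. suffix k w \<Turnstile> \<psi> \<and> (\<forall>j<k. suffix j w \<Turnstile> \<phi>))"
| "w \<Turnstile> GF \<phi> \<longleftrightarrow> infinite {i. suffix i w \<Turnstile> \<phi>}"
| "w \<Turnstile> FG \<phi> \<longleftrightarrow> finite {i. \<not> suffix i w \<Turnstile> \<phi>}"

definition equivalent :: "'a set \<Rightarrow> 'a ltl \<Rightarrow> 'a ltl \<Rightarrow> bool" where
  "equivalent Ap \<phi> \<psi> \<longleftrightarrow> (\<forall>w. range w \<subseteq> Pow Ap \<longrightarrow> (w \<Turnstile> \<phi> \<longleftrightarrow> w \<Turnstile> \<psi>))"

primrec children :: "'a ltl \<Rightarrow> 'a ltl list" where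
  "children LTrue = []"
| "children LFalse = []"
| "children (Prop a) = []"
| "children (NProp a) = []"
| "children (And \<phi> \<psi>) = [\<phi>, \<psi>]"
| "children (Or \<phi> \<psi>) = [\<phi>, \<psi>]"
| "children (Next \<phi>) = [\<phi>]"
| "children (Until \<phi> \<psi>) = [\<phi>, \<psi>]"
| "children (WeakUntil \<phi> \<psi>) = [\<phi>, \<psi>]"
| "children (GF \<phi>) = [\<phi>]"
| "children (FG \<phi>) = [\<phi>]"

(* A node of the syntax tree is represented by the list of child indices on the path from
   the root to it, so distinct occurrences of the same subformula are distinct nodes. *)
inductive_set nodes_in :: "('a ltl \<times> nat list) set" where
  "(\<phi>, []) \<in> nodes_in"
| "i < length (children \<phi>) \<Longrightarrow> (children \<phi> ! i, p) \<in> nodes_in \<Longrightarrow> (\<phi>, i # p) \<in> nodes_in"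

definition nodes :: "'a ltl \<Rightarrow> nat list set" where
  "nodes \<phi> = {p. (\<phi>, p) \<in> nodes_in}"

(* Meaningful only if the path is a node of the formula. *)
primrec subformula_at :: "'a ltl \<Rightarrow> nat list \<Rightarrow> 'a ltl" where
  "subformula_at \<phi> [] = \<phi>"
| "subformula_at \<phi> (i # p) = subformula_at (children \<phi> ! i) p"

(* The size function generated by the datatype package does not count leaves. *)
definition num_nodes :: "'a ltl \<Rightarrow> nat" where
  "num_nodes \<phi> = card (nodes \<phi>)"

definition is_limit :: "'a ltl \<Rightarrow> bool" where
  "is_limit \<phi> \<longleftrightarrow> is_GF \<phi> \<or> is_FG \<phi>"

definition is_temporal :: "'a ltl \<Rightarrow> bool" where
  "is_temporal \<phi> \<longleftrightarrow> is_Until \<phi> \<or> is_WeakUntil \<phi> \<or> is_Next \<phi> \<or> is_limit \<phi>"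

(* No P-node lies under a Q-node; proper descendants are proper extensions of the path. *)
definition none_under :: "('a ltl \<Rightarrow> bool) \<Rightarrow> ('a ltl \<Rightarrow> bool) \<Rightarrow> 'a ltl \<Rightarrow> bool" where
  "none_under P Q \<phi> \<longleftrightarrow>
     \<not> (\<exists>p\<in>nodes \<phi>. \<exists>q\<in>nodes \<phi>.
          P (subformula_at \<phi> p) \<and> Q (subformula_at \<phi> q) \<and> strict_prefix q p)"

definition normal_form :: "'a ltl \<Rightarrow> bool" where
  "normal_form \<phi> \<longleftrightarrow>
     none_under is_Until is_WeakUntil \<phi> \<and>
     none_under is_limit is_temporal \<phi> \<and>
     none_under is_WeakUntil is_GF \<phi> \<and>
     none_under is_Until is_FG \<phi>"

lemma nodes_children:
  "nodes \<phi> = insert [] (\<Union>i<length (children \<phi>). (#) i ` nodes (children \<phi> ! i))"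
proof (rule set_eqI)
  fix p
  show "p \<in> nodes \<phi> \<longleftrightarrow>
      p \<in> insert [] (\<Union>i<length (children \<phi>). (#) i ` nodes (children \<phi> ! i))"
    unfolding nodes_def mem_Collect_eq by (subst nodes_in.simps) auto
qed

lemma finite_nodes: "finite (nodes \<phi>)"
  by (induction \<phi>; subst nodes_children) (auto simp: less_Suc_eq numeral_2_eq_2)

lemma num_nodes_children: "num_nodes \<phi> = Suc (sum_list (map num_nodes (children \<phi>)))"
proof -
  let ?U = "\<Union>i<length (children \<phi>). (#) i ` nodes (children \<phi> ! i)"
  have "card ?U = (\<Sum>i<length (children \<phi>). card ((#) i ` nodes (children \<phi> ! i)))"
    by (rule card_UN_disjoint) (auto simp: finite_nodes)
  also have "\<dots> = (\<Sum>i<length (children \<phi>). num_nodes (children \<phi> ! i))"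
    by (simp add: num_nodes_def card_image)
  also have "\<dots> = sum_list (map num_nodes (children \<phi>))"
    by (simp add: sum_list_sum_nth atLeast0LessThan)
  finally have "card ?U = sum_list (map num_nodes (children \<phi>))" .
  moreover have "finite ?U" by (simp add: finite_nodes)
  moreover have "[] \<notin> ?U" by auto
  ultimately show ?thesis
    unfolding num_nodes_def by (subst nodes_children) simp
qed

end

theory Submission
  imports Defs
begin

text \<open>
  For a word \<open>w\<close>, guess the set \<open>S\<close> of those \<open>U\<close>-subformulas that hold infinitely often, of those
  \<open>W\<close>-subformulas that hold almost always, and of those limit subformulas that hold. Relative to a
  correct guess every limit subformula becomes a constant, \<open>a U b\<close> becomes eventually equivalent
  to \<open>a W b\<close> (if guessed) or \<open>ff\<close> (otherwise), and \<open>a W b\<close> becomes eventually equivalent to \<open>tt\<close>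
  or \<open>a U b\<close>. Since \<open>a W b\<close> is \<open>a U (b \<or> G a)\<close> and the equivalences hold from some point on, it
  suffices to remove \<open>U\<close> below the inner \<open>G\<close>. The correctness of the guess is itself expressed by
  \<open>GF\<close> of \<open>W\<close>-free and \<open>FG\<close> of \<open>U\<close>-free formulas; the apparent circularity is resolved by
  induction on the subformulas. The normal form is the disjunction over all guesses.
\<close>

section \<open>Syntax trees\<close>

lemma num_nodes_simps [simp]:
  "num_nodes LTrue = 1" "num_nodes LFalse = 1" "num_nodes (Prop x) = 1" "num_nodes (NProp x) = 1"
  "num_nodes (And a b) = Suc (num_nodes a + num_nodes b)"
  "num_nodes (Or a b) = Suc (num_nodes a + num_nodes b)"
  "num_nodes (Next a) = Suc (num_nodes a)"
  "num_nodes (Until a b) = Suc (num_nodes a + num_nodes b)"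
  "num_nodes (WeakUntil a b) = Suc (num_nodes a + num_nodes b)"
  "num_nodes (GF a) = Suc (num_nodes a)"
  "num_nodes (FG a) = Suc (num_nodes a)"
  by (subst num_nodes_children; simp)+

lemma num_nodes_pos: "num_nodes \<phi> \<ge> 1"
  by (subst num_nodes_children) simp

definition free_of :: "('a ltl \<Rightarrow> bool) \<Rightarrow> 'a ltl \<Rightarrow> bool" where
  "free_of P \<phi> \<longleftrightarrow> (\<forall>p\<in>nodes \<phi>. \<not> P (subformula_at \<phi> p))"

lemma free_of_children:
  "free_of P \<phi> \<longleftrightarrow> \<not> P \<phi> \<and> (\<forall>c\<in>set (children \<phi>). free_of P c)"
  unfolding free_of_def by (subst nodes_children) (fastforce simp: in_set_conv_nth)

text \<open>Of two nodes with one strictly above the other, either both lie below the same child or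
  the upper one is the root. This trades paths for structural recursion, so that normal forms can be
  checked by simplification.\<close>

lemma none_under_children:
  "none_under P Q \<phi> \<longleftrightarrow>
     (\<forall>c\<in>set (children \<phi>). none_under P Q c) \<and> (Q \<phi> \<longrightarrow> (\<forall>c\<in>set (children \<phi>). free_of P c))"
  (is "_ \<longleftrightarrow> ?R")
proof
  assume L: "none_under P Q \<phi>"
  have "none_under P Q (children \<phi> ! i)" if "i < length (children \<phi>)" for i
    unfolding none_under_def
  proof (clarify)
    fix p q
    assume *: "p \<in> nodes (children \<phi> ! i)" "q \<in> nodes (children \<phi> ! i)"
      "P (subformula_at (children \<phi> ! i) p)" "Q (subformula_at (children \<phi> ! i) q)"
      "strict_prefix q p"
    have "i # p \<in> nodes \<phi>" "i # q \<in> nodes \<phi>"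
      using * that by (subst nodes_children, blast)+
    moreover have "strict_prefix (i # q) (i # p)" using * by simp
    ultimately show False using L * unfolding none_under_def
      by (metis subformula_at.simps(2))
  qed
  moreover have "free_of P (children \<phi> ! i)" if "i < length (children \<phi>)" "Q \<phi>" for i
    unfolding free_of_def
  proof (clarify)
    fix p
    assume *: "p \<in> nodes (children \<phi> ! i)" "P (subformula_at (children \<phi> ! i) p)"
    have "i # p \<in> nodes \<phi>" "[] \<in> nodes \<phi>"
      using * that by (subst nodes_children, blast)+
    moreover have "strict_prefix [] (i # p)" by simp
    ultimately show False using L * that unfolding none_under_def
      by (metis subformula_at.simps)
  qed
  ultimately show ?R by (auto simp: in_set_conv_nth)
next
  assume R: ?R
  show "none_under P Q \<phi>"
    unfolding none_under_def
  proof (clarify)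
    fix p q
    assume *: "p \<in> nodes \<phi>" "q \<in> nodes \<phi>" "P (subformula_at \<phi> p)" "Q (subformula_at \<phi> q)"
      "strict_prefix q p"
    then obtain i p' where p: "p = i # p'" by (cases p) auto
    with *(1) have i: "i < length (children \<phi>)" "p' \<in> nodes (children \<phi> ! i)"
      by (subst (asm) nodes_children, auto)+
    then have c: "children \<phi> ! i \<in> set (children \<phi>)" by simp
    show False
    proof (cases q)
      case Nil
      then show False using R * p i c by (auto simp: free_of_def)
    next
      case (Cons j q')
      then have "j = i" "strict_prefix q' p'" using * p by auto
      moreover have "q' \<in> nodes (children \<phi> ! i)"
        using *(2) Cons \<open>j = i\<close> by (subst (asm) nodes_children) auto
      moreover have "none_under P Q (children \<phi> ! i)" using R c by blast
      ultimately show False using * p Cons i unfolding none_under_def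
        by (metis subformula_at.simps(2))
    qed
  qed
qed

lemmas free_of_simps [simp] =
  free_of_children [of _ LTrue, simplified] free_of_children [of _ LFalse, simplified]
  free_of_children [of _ "Prop x" for x, simplified]
  free_of_children [of _ "NProp x" for x, simplified]
  free_of_children [of _ "And a b" for a b, simplified]
  free_of_children [of _ "Or a b" for a b, simplified]
  free_of_children [of _ "Next a" for a, simplified]
  free_of_children [of _ "Until a b" for a b, simplified]
  free_of_children [of _ "WeakUntil a b" for a b, simplified]
  free_of_children [of _ "GF a" for a, simplified]
  free_of_children [of _ "FG a" for a, simplified]

lemmas none_under_simps [simp] =
  none_under_children [of _ _ LTrue, simplified] none_under_children [of _ _ LFalse, simplified]
  none_under_children [of _ _ "Prop x" for x, simplified]
  none_under_children [of _ _ "NProp x" for x, simplified]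
  none_under_children [of _ _ "And a b" for a b, simplified]
  none_under_children [of _ _ "Or a b" for a b, simplified]
  none_under_children [of _ _ "Next a" for a, simplified]
  none_under_children [of _ _ "Until a b" for a b, simplified]
  none_under_children [of _ _ "WeakUntil a b" for a b, simplified]
  none_under_children [of _ _ "GF a" for a, simplified]
  none_under_children [of _ _ "FG a" for a, simplified]

lemma free_of_imp_none_under: "free_of P \<phi> \<Longrightarrow> none_under P Q \<phi>"
  by (auto simp: free_of_def none_under_def)

lemma is_limit_simps [simp]:
  "\<not> is_limit LTrue" "\<not> is_limit LFalse" "\<not> is_limit (Prop x)" "\<not> is_limit (NProp x)"
  "\<not> is_limit (And a b)" "\<not> is_limit (Or a b)" "\<not> is_limit (Next a)"
  "\<not> is_limit (Until a b)" "\<not> is_limit (WeakUntil a b)" "is_limit (GF a)" "is_limit (FG a)"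
  by (simp_all add: is_limit_def)

lemma is_temporal_simps [simp]:
  "\<not> is_temporal (And a b)" "\<not> is_temporal (Or a b)"
  by (simp_all add: is_temporal_def)

section \<open>Relativisation to a guess\<close>

text \<open>A list, so that \<open>subseqs\<close> enumerates the guesses and the length bounds
  their number; repeated entries do no harm.\<close>

primrec guessable :: "'a ltl \<Rightarrow> 'a ltl list" where
  "guessable LTrue = []"
| "guessable LFalse = []"
| "guessable (Prop x) = []"
| "guessable (NProp x) = []"
| "guessable (And a b) = guessable a @ guessable b"
| "guessable (Or a b) = guessable a @ guessable b"
| "guessable (Next a) = guessable a"
| "guessable (Until a b) = Until a b # guessable a @ guessable b"
| "guessable (WeakUntil a b) = WeakUntil a b # guessable a @ guessable b"
| "guessable (GF a) = GF a # guessable a"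
| "guessable (FG a) = FG a # guessable a"

text \<open>Meant to stand under \<open>GF\<close>, so \<open>WeakUntil\<close> and limit operators
  must disappear. An unguessed \<open>WeakUntil\<close> may become an \<open>Until\<close>: where it
  does not hold almost always, the two agree.\<close>

primrec sigma1 :: "'a ltl set \<Rightarrow> 'a ltl \<Rightarrow> 'a ltl" where
  "sigma1 S LTrue = LTrue"
| "sigma1 S LFalse = LFalse"
| "sigma1 S (Prop x) = Prop x"
| "sigma1 S (NProp x) = NProp x"
| "sigma1 S (And a b) = And (sigma1 S a) (sigma1 S b)"
| "sigma1 S (Or a b) = Or (sigma1 S a) (sigma1 S b)"
| "sigma1 S (Next a) = Next (sigma1 S a)"
| "sigma1 S (Until a b) = Until (sigma1 S a) (sigma1 S b)"
| "sigma1 S (WeakUntil a b) =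
     (if WeakUntil a b \<in> S then LTrue else Until (sigma1 S a) (sigma1 S b))"
| "sigma1 S (GF a) = (if GF a \<in> S then LTrue else LFalse)"
| "sigma1 S (FG a) = (if FG a \<in> S then LTrue else LFalse)"

text \<open>Dual to \<open>sigma1\<close>, meant to stand under \<open>FG\<close> or
  \<open>WeakUntil\<close>, so \<open>Until\<close> must disappear. A guessed \<open>Until\<close>
  holds infinitely often and then agrees with the corresponding \<open>WeakUntil\<close>; an
  unguessed one is eventually false.\<close>

primrec pi1 :: "'a ltl set \<Rightarrow> 'a ltl \<Rightarrow> 'a ltl" where
  "pi1 S LTrue = LTrue"
| "pi1 S LFalse = LFalse"
| "pi1 S (Prop x) = Prop x"
| "pi1 S (NProp x) = NProp x"
| "pi1 S (And a b) = And (pi1 S a) (pi1 S b)"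
| "pi1 S (Or a b) = Or (pi1 S a) (pi1 S b)"
| "pi1 S (Next a) = Next (pi1 S a)"
| "pi1 S (Until a b) = (if Until a b \<in> S then WeakUntil (pi1 S a) (pi1 S b) else LFalse)"
| "pi1 S (WeakUntil a b) = WeakUntil (pi1 S a) (pi1 S b)"
| "pi1 S (GF a) = (if GF a \<in> S then LTrue else LFalse)"
| "pi1 S (FG a) = (if FG a \<in> S then LTrue else LFalse)"

text \<open>\<open>WeakUntil (pi1 S a) LFalse\<close> encodes G of \<open>pi1 S a\<close>. This
  translation must be exact at the first position, whereas \<open>pi1\<close> is complete only
  eventually; the outer \<open>Until\<close> can wait for that moment.\<close>

primrec sigma2 :: "'a ltl set \<Rightarrow> 'a ltl \<Rightarrow> 'a ltl" where
  "sigma2 S LTrue = LTrue"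
| "sigma2 S LFalse = LFalse"
| "sigma2 S (Prop x) = Prop x"
| "sigma2 S (NProp x) = NProp x"
| "sigma2 S (And a b) = And (sigma2 S a) (sigma2 S b)"
| "sigma2 S (Or a b) = Or (sigma2 S a) (sigma2 S b)"
| "sigma2 S (Next a) = Next (sigma2 S a)"
| "sigma2 S (Until a b) = Until (sigma2 S a) (sigma2 S b)"
| "sigma2 S (WeakUntil a b) =
     Until (sigma2 S a) (Or (sigma2 S b) (WeakUntil (pi1 S a) LFalse))"
| "sigma2 S (GF a) = (if GF a \<in> S then LTrue else LFalse)"
| "sigma2 S (FG a) = (if FG a \<in> S then LTrue else LFalse)"

fun correct_guess :: "'a set word \<Rightarrow> 'a ltl \<Rightarrow> bool" where
  "correct_guess w (Until a b) \<longleftrightarrow> w \<Turnstile> GF (Until a b)"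
| "correct_guess w (WeakUntil a b) \<longleftrightarrow> w \<Turnstile> FG (WeakUntil a b)"
| "correct_guess w \<phi> \<longleftrightarrow> w \<Turnstile> \<phi>"

text \<open>Only membership in the guess is checked, never absence. Omitting a correct formula
  merely strengthens the relativised formulas, which can cost completeness of that disjunct but not
  soundness.\<close>

fun guess_check :: "'a ltl set \<Rightarrow> 'a ltl \<Rightarrow> 'a ltl" where
  "guess_check S (Until a b) = GF (sigma1 S (Until a b))"
| "guess_check S (WeakUntil a b) = FG (pi1 S (WeakUntil a b))"
| "guess_check S (GF a) = GF (sigma1 S a)"
| "guess_check S (FG a) = FG (pi1 S a)"
| "guess_check S \<phi> = LTrue"

section \<open>Correctness of the relativisation\<close>

lemma sat_GF_iff: "w \<Turnstile> GF \<phi> \<longleftrightarrow> (\<exists>\<^sub>F i in sequentially. suffix i w \<Turnstile> \<phi>)"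
  by (simp add: frequently_cofinite flip: cofinite_eq_sequentially)

lemma sat_FG_iff: "w \<Turnstile> FG \<phi> \<longleftrightarrow> (\<forall>\<^sub>F i in sequentially. suffix i w \<Turnstile> \<phi>)"
  by (simp add: eventually_cofinite flip: cofinite_eq_sequentially)

lemma suffix_sat_FG [simp]: "suffix k w \<Turnstile> FG \<phi> \<longleftrightarrow> w \<Turnstile> FG \<phi>"
  unfolding sat_FG_iff
  using eventually_sequentially_seg [of "\<lambda>i. suffix i w \<Turnstile> \<phi>" k] by (simp add: add.commute)

lemma suffix_sat_GF [simp]: "suffix k w \<Turnstile> GF \<phi> \<longleftrightarrow> w \<Turnstile> GF \<phi>"
  unfolding sat_GF_iff frequently_def
  using eventually_sequentially_seg [of "\<lambda>i. \<not> suffix i w \<Turnstile> \<phi>" k] by (simp add: add.commute)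

declare sat.simps(10,11) [simp del]

text \<open>The induction method eta-expands \<open>suffix i w\<close>, so this rule would destroy suffixes.\<close>
declare suffix_nth [simp del]

section \<open>Monotonicity of U and W, and conditions under which they agree\<close>

text \<open>The implications are required only from position \<open>i\<close> on, so implications
  that hold merely eventually can be lifted through the operator at late positions.\<close>

lemma until_mono:
  assumes "suffix i w \<Turnstile> Until a b"
    and "\<And>j. i \<le> j \<Longrightarrow> suffix j w \<Turnstile> a \<Longrightarrow> suffix j w \<Turnstile> a'"
    and "\<And>j. i \<le> j \<Longrightarrow> suffix j w \<Turnstile> b \<Longrightarrow> suffix j w \<Turnstile> b'"
  shows "suffix i w \<Turnstile> Until a' b'"
  using assms unfolding sat.simps suffix_suffix by (meson le_add1)

lemma weak_until_mono:
  assumes "suffix i w \<Turnstile> WeakUntil a b"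
    and "\<And>j. i \<le> j \<Longrightarrow> suffix j w \<Turnstile> a \<Longrightarrow> suffix j w \<Turnstile> a'"
    and "\<And>j. i \<le> j \<Longrightarrow> suffix j w \<Turnstile> b \<Longrightarrow> suffix j w \<Turnstile> b'"
  shows "suffix i w \<Turnstile> WeakUntil a' b'"
  using assms unfolding sat.simps suffix_suffix by (meson le_add1)

lemma until_imp_weak_until: "w \<Turnstile> Until a b \<Longrightarrow> w \<Turnstile> WeakUntil a b"
  by simp

text \<open>If \<open>a\<close> holds forever, a later position satisfying the \<open>Until\<close>
  supplies the missing \<open>b\<close>; otherwise the \<open>WeakUntil\<close> is already an
  \<open>Until\<close>.\<close>

lemma weak_until_imp_until:
  assumes W: "suffix i w \<Turnstile> WeakUntil a b" and inf: "w \<Turnstile> GF (Until a b)"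
  shows "suffix i w \<Turnstile> Until a b"
proof (cases "\<forall>k. suffix k (suffix i w) \<Turnstile> a")
  case True
  obtain j where "j \<ge> i" "suffix j w \<Turnstile> Until a b"
    using inf unfolding sat_GF_iff frequently_sequentially by blast
  then obtain k where "suffix (j + k) w \<Turnstile> b" by auto
  then have "suffix (j + k - i) (suffix i w) \<Turnstile> b" using \<open>j \<ge> i\<close> by simp
  then show ?thesis using True unfolding sat.simps by blast
next
  case False
  then show ?thesis using W unfolding sat.simps by blast
qed

text \<open>Without the \<open>Until\<close>, \<open>a\<close> holds forever from \<open>i\<close>
  on, and then the \<open>WeakUntil\<close> would hold at all later positions.\<close>

lemma weak_until_imp_until_if_not_FG:
  assumes W: "suffix i w \<Turnstile> WeakUntil a b" and "\<not> w \<Turnstile> FG (WeakUntil a b)"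
  shows "suffix i w \<Turnstile> Until a b"
proof (rule ccontr)
  assume "\<not> ?thesis"
  then have *: "suffix k (suffix i w) \<Turnstile> a" for k using W by auto
  have "suffix j w \<Turnstile> WeakUntil a b" if "j \<ge> i" for j
  proof -
    have "suffix k (suffix j w) \<Turnstile> a" for k
      using * [of "j - i + k"] that by (simp add: add.commute)
    then show ?thesis by simp
  qed
  then have "w \<Turnstile> FG (WeakUntil a b)"
    unfolding sat_FG_iff eventually_sequentially by blast
  with assms show False by blast
qed

section \<open>Soundness: from relativised formulas back to the originals\<close>

text \<open>Valid at every position: a guessed \<open>Until\<close> recurs by assumption, which
  turns the \<open>WeakUntil\<close> back into an \<open>Until\<close>. The hypothesis exempts
  \<open>WeakUntil\<close> formulas, on which \<open>pi1\<close> never consults \<open>S\<close>;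
  this later breaks the circularity.\<close>

lemma pi1_sound:
  assumes "\<forall>t\<in>set (guessable \<phi>) \<inter> S. \<not> is_WeakUntil t \<longrightarrow> correct_guess w t"
    and "suffix i w \<Turnstile> pi1 S \<phi>"
  shows "suffix i w \<Turnstile> \<phi>"
  using assms
proof (induction \<phi> arbitrary: i)
  case (Until a b)
  then have U: "Until a b \<in> S" and W: "suffix i w \<Turnstile> WeakUntil (pi1 S a) (pi1 S b)"
    by (metis pi1.simps(8) sat.simps(2))+
  have "suffix i w \<Turnstile> WeakUntil a b"
    by (rule weak_until_mono [OF W]) (use Until.IH Until.prems(1) in auto)
  moreover have "w \<Turnstile> GF (Until a b)" using Until.prems(1) U by auto
  ultimately show ?case by (rule weak_until_imp_until)
next
  case (WeakUntil a b)
  then have W: "suffix i w \<Turnstile> WeakUntil (pi1 S a) (pi1 S b)" by simp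
  show ?case by (rule weak_until_mono [OF W]) (use WeakUntil.IH WeakUntil.prems(1) in auto)
qed (auto split: if_splits)

text \<open>In the \<open>WeakUntil\<close> case the translation is first brought back to
  \<open>Until a (Or b (WeakUntil a LFalse))\<close>, which is equivalent to
  \<open>WeakUntil a b\<close>; \<open>pi1_sound\<close> handles the part under the inner
  \<open>WeakUntil\<close>.\<close>

lemma sigma2_sound:
  assumes "\<forall>t\<in>set (guessable \<phi>) \<inter> S. correct_guess w t"
    and "suffix i w \<Turnstile> sigma2 S \<phi>"
  shows "suffix i w \<Turnstile> \<phi>"
  using assms
proof (induction \<phi> arbitrary: i)
  case (Until a b)
  then have U: "suffix i w \<Turnstile> Until (sigma2 S a) (sigma2 S b)" by simp
  show ?case by (rule until_mono [OF U]) (use Until.IH Until.prems(1) in auto)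
next
  case (WeakUntil a b)
  have "suffix i w \<Turnstile> Until (sigma2 S a) (Or (sigma2 S b) (WeakUntil (pi1 S a) LFalse))"
    using WeakUntil.prems by simp
  then have "suffix i w \<Turnstile> Until a (Or b (WeakUntil a LFalse))"
  proof (rule until_mono)
    fix j
    assume *: "suffix j w \<Turnstile> Or (sigma2 S b) (WeakUntil (pi1 S a) LFalse)"
    have pi: "suffix j w \<Turnstile> pi1 S a \<Longrightarrow> suffix j w \<Turnstile> a" for j
      by (rule pi1_sound) (use WeakUntil.prems in auto)
    have "suffix j w \<Turnstile> sigma2 S b \<or> suffix j w \<Turnstile> WeakUntil (pi1 S a) LFalse"
      using * by simp
    then show "suffix j w \<Turnstile> Or b (WeakUntil a LFalse)"
    proof
      assume "suffix j w \<Turnstile> sigma2 S b"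
      then show ?thesis using WeakUntil.IH(2) WeakUntil.prems(1) by simp
    next
      assume "suffix j w \<Turnstile> WeakUntil (pi1 S a) LFalse"
      then have "suffix j w \<Turnstile> WeakUntil a LFalse"
        by (rule weak_until_mono) (auto intro: pi)
      then show ?thesis by simp
    qed
  qed (use WeakUntil.IH(1) WeakUntil.prems(1) in auto)
  \<comment> \<open>\<open>k\<close> is where the \<open>Until\<close> is discharged, by
    \<open>b\<close> or by \<open>a\<close> holding forever from there. In the second case prefix
    and tail together give \<open>a\<close> everywhere.\<close>
  then obtain k where k: "suffix (i + k) w \<Turnstile> b \<or> (\<forall>l. suffix (i + k + l) w \<Turnstile> a)"
    "\<forall>j<k. suffix (i + j) w \<Turnstile> a" by auto
  show ?case
  proof (cases "suffix (i + k) w \<Turnstile> b")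
    case False
    then have "suffix (i + j) w \<Turnstile> a" for j
      using k by (cases "j < k") (auto simp: le_iff_add add.assoc not_less)
    then show ?thesis by (simp add: add.commute)
  qed (use k in auto)
qed (auto split: if_splits)

text \<open>Only eventual: a guessed \<open>WeakUntil\<close> becomes \<open>LTrue\<close>, which is
  justified only once that formula holds forever. \<open>Until\<close> formulas are exempt because
  \<open>sigma1\<close> never consults \<open>S\<close> on them.\<close>

lemma sigma1_sound:
  assumes "\<forall>t\<in>set (guessable \<phi>) \<inter> S. \<not> is_Until t \<longrightarrow> correct_guess w t"
  shows "\<forall>\<^sub>F i in sequentially. suffix i w \<Turnstile> sigma1 S \<phi> \<longrightarrow> suffix i w \<Turnstile> \<phi>"
  using assms
proof (induction \<phi>)
  case (And a b)
  then have "\<forall>\<^sub>F i in sequentially. suffix i w \<Turnstile> sigma1 S a \<longrightarrow> suffix i w \<Turnstile> a"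
    "\<forall>\<^sub>F i in sequentially. suffix i w \<Turnstile> sigma1 S b \<longrightarrow> suffix i w \<Turnstile> b" by auto
  then show ?case by eventually_elim auto
next
  case (Or a b)
  then have "\<forall>\<^sub>F i in sequentially. suffix i w \<Turnstile> sigma1 S a \<longrightarrow> suffix i w \<Turnstile> a"
    "\<forall>\<^sub>F i in sequentially. suffix i w \<Turnstile> sigma1 S b \<longrightarrow> suffix i w \<Turnstile> b" by auto
  then show ?case by eventually_elim auto
next
  case (Next a)
  then obtain n where "\<And>i. i \<ge> n \<Longrightarrow> suffix i w \<Turnstile> sigma1 S a \<longrightarrow> suffix i w \<Turnstile> a"
    by (auto simp: eventually_sequentially)
  then show ?case by (auto simp: eventually_sequentially intro!: exI [of _ n])
next
  case (Until a b)
  then have "\<forall>\<^sub>F i in sequentially. suffix i w \<Turnstile> sigma1 S a \<longrightarrow> suffix i w \<Turnstile> a"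
    "\<forall>\<^sub>F i in sequentially. suffix i w \<Turnstile> sigma1 S b \<longrightarrow> suffix i w \<Turnstile> b" by auto
  \<comment> \<open>\<open>until_mono\<close> needs the implications at all positions from
    \<open>i\<close> on, not only at \<open>i\<close>.\<close>
  then have "\<forall>\<^sub>F i in sequentially. \<forall>j\<ge>i.
      (suffix j w \<Turnstile> sigma1 S a \<longrightarrow> suffix j w \<Turnstile> a) \<and> (suffix j w \<Turnstile> sigma1 S b \<longrightarrow> suffix j w \<Turnstile> b)"
    by (intro eventually_all_ge_at_top eventually_conj)
  then show ?case
  proof eventually_elim
    case (elim i)
    show ?case
    proof
      assume "suffix i w \<Turnstile> sigma1 S (Until a b)"
      then have "suffix i w \<Turnstile> Until (sigma1 S a) (sigma1 S b)" by simp
      then show "suffix i w \<Turnstile> Until a b" by (rule until_mono) (use elim in blast)+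
    qed
  qed
next
  case (WeakUntil a b)
  show ?case
  proof (cases "WeakUntil a b \<in> S")
    case True
    then have "w \<Turnstile> FG (WeakUntil a b)" using WeakUntil.prems by auto
    then show ?thesis unfolding sat_FG_iff by eventually_elim blast
  next
    case False
    from WeakUntil have "\<forall>\<^sub>F i in sequentially. suffix i w \<Turnstile> sigma1 S a \<longrightarrow> suffix i w \<Turnstile> a"
      "\<forall>\<^sub>F i in sequentially. suffix i w \<Turnstile> sigma1 S b \<longrightarrow> suffix i w \<Turnstile> b" by auto
    then have "\<forall>\<^sub>F i in sequentially. \<forall>j\<ge>i.
        (suffix j w \<Turnstile> sigma1 S a \<longrightarrow> suffix j w \<Turnstile> a) \<and> (suffix j w \<Turnstile> sigma1 S b \<longrightarrow> suffix j w \<Turnstile> b)"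
      by (intro eventually_all_ge_at_top eventually_conj)
    then show ?thesis
    proof eventually_elim
      case (elim i)
      show ?case
      proof
        assume "suffix i w \<Turnstile> sigma1 S (WeakUntil a b)"
        then have "suffix i w \<Turnstile> Until (sigma1 S a) (sigma1 S b)" using False by simp
        then have "suffix i w \<Turnstile> Until a b" by (rule until_mono) (use elim in blast)+
        then show "suffix i w \<Turnstile> WeakUntil a b" by (rule until_imp_weak_until)
      qed
    qed
  qed
qed auto

section \<open>Completeness: from the originals to relativised formulas\<close>

text \<open>Valid at every position: a \<open>WeakUntil\<close> outside \<open>S\<close> does not
  hold almost always, so \<open>weak_until_imp_until_if_not_FG\<close> applies.\<close>

lemma sigma1_complete:
  assumes "\<forall>t\<in>set (guessable \<phi>). correct_guess w t \<longrightarrow> t \<in> S"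
    and "suffix i w \<Turnstile> \<phi>"
  shows "suffix i w \<Turnstile> sigma1 S \<phi>"
  using assms
proof (induction \<phi> arbitrary: i)
  case (Until a b)
  have "suffix i w \<Turnstile> Until (sigma1 S a) (sigma1 S b)"
    by (rule until_mono [OF Until.prems(2)]) (use Until.IH Until.prems(1) in auto)
  then show ?case by simp
next
  case (WeakUntil a b)
  show ?case
  proof (cases "WeakUntil a b \<in> S")
    case False
    then have "suffix i w \<Turnstile> Until a b"
      using WeakUntil.prems by (intro weak_until_imp_until_if_not_FG) auto
    then have "suffix i w \<Turnstile> Until (sigma1 S a) (sigma1 S b)"
      by (rule until_mono) (use WeakUntil.IH WeakUntil.prems(1) in auto)
    then show ?thesis using False by simp
  qed simp
qed auto

text \<open>Only eventual: an \<open>Until\<close> outside \<open>S\<close> becomes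
  \<open>LFalse\<close>, which is right only after the last position where it holds.\<close>

lemma pi1_complete:
  assumes "\<forall>t\<in>set (guessable \<phi>). correct_guess w t \<longrightarrow> t \<in> S"
  shows "\<forall>\<^sub>F i in sequentially. suffix i w \<Turnstile> \<phi> \<longrightarrow> suffix i w \<Turnstile> pi1 S \<phi>"
  using assms
proof (induction \<phi>)
  case (And a b)
  then have "\<forall>\<^sub>F i in sequentially. suffix i w \<Turnstile> a \<longrightarrow> suffix i w \<Turnstile> pi1 S a"
    "\<forall>\<^sub>F i in sequentially. suffix i w \<Turnstile> b \<longrightarrow> suffix i w \<Turnstile> pi1 S b" by auto
  then show ?case by eventually_elim auto
next
  case (Or a b)
  then have "\<forall>\<^sub>F i in sequentially. suffix i w \<Turnstile> a \<longrightarrow> suffix i w \<Turnstile> pi1 S a"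
    "\<forall>\<^sub>F i in sequentially. suffix i w \<Turnstile> b \<longrightarrow> suffix i w \<Turnstile> pi1 S b" by auto
  then show ?case by eventually_elim auto
next
  case (Next a)
  then obtain n where "\<And>i. i \<ge> n \<Longrightarrow> suffix i w \<Turnstile> a \<longrightarrow> suffix i w \<Turnstile> pi1 S a"
    by (auto simp: eventually_sequentially)
  then show ?case by (auto simp: eventually_sequentially intro!: exI [of _ n])
next
  case (Until a b)
  show ?case
  proof (cases "Until a b \<in> S")
    case False
    then have "\<not> w \<Turnstile> GF (Until a b)" using Until.prems by auto
    then show ?thesis unfolding sat_GF_iff not_frequently by eventually_elim blast
  next
    case True
    from Until have "\<forall>\<^sub>F i in sequentially. suffix i w \<Turnstile> a \<longrightarrow> suffix i w \<Turnstile> pi1 S a"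
      "\<forall>\<^sub>F i in sequentially. suffix i w \<Turnstile> b \<longrightarrow> suffix i w \<Turnstile> pi1 S b" by auto
    then have "\<forall>\<^sub>F i in sequentially. \<forall>j\<ge>i.
        (suffix j w \<Turnstile> a \<longrightarrow> suffix j w \<Turnstile> pi1 S a) \<and> (suffix j w \<Turnstile> b \<longrightarrow> suffix j w \<Turnstile> pi1 S b)"
      by (intro eventually_all_ge_at_top eventually_conj)
    then show ?thesis
    proof eventually_elim
      case (elim i)
      show ?case
      proof
        assume "suffix i w \<Turnstile> Until a b"
        then have "suffix i w \<Turnstile> WeakUntil a b" by (rule until_imp_weak_until)
        then have "suffix i w \<Turnstile> WeakUntil (pi1 S a) (pi1 S b)"
          by (rule weak_until_mono) (use elim in blast)+
        then show "suffix i w \<Turnstile> pi1 S (Until a b)" using True by simp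
      qed
    qed
  qed
next
  case (WeakUntil a b)
  then have "\<forall>\<^sub>F i in sequentially. suffix i w \<Turnstile> a \<longrightarrow> suffix i w \<Turnstile> pi1 S a"
    "\<forall>\<^sub>F i in sequentially. suffix i w \<Turnstile> b \<longrightarrow> suffix i w \<Turnstile> pi1 S b" by auto
  then have "\<forall>\<^sub>F i in sequentially. \<forall>j\<ge>i.
      (suffix j w \<Turnstile> a \<longrightarrow> suffix j w \<Turnstile> pi1 S a) \<and> (suffix j w \<Turnstile> b \<longrightarrow> suffix j w \<Turnstile> pi1 S b)"
    by (intro eventually_all_ge_at_top eventually_conj)
  then show ?case
  proof eventually_elim
    case (elim i)
    show ?case
    proof
      assume "suffix i w \<Turnstile> WeakUntil a b"
      then have "suffix i w \<Turnstile> WeakUntil (pi1 S a) (pi1 S b)"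
        by (rule weak_until_mono) (use elim in blast)+
      then show "suffix i w \<Turnstile> pi1 S (WeakUntil a b)" by simp
    qed
  qed
qed auto

lemma sigma2_complete:
  assumes "\<forall>t\<in>set (guessable \<phi>). correct_guess w t \<longrightarrow> t \<in> S"
    and "suffix i w \<Turnstile> \<phi>"
  shows "suffix i w \<Turnstile> sigma2 S \<phi>"
  using assms
proof (induction \<phi> arbitrary: i)
  case (Until a b)
  have "suffix i w \<Turnstile> Until (sigma2 S a) (sigma2 S b)"
    by (rule until_mono [OF Until.prems(2)]) (use Until.IH Until.prems(1) in auto)
  then show ?case by simp
next
  case (WeakUntil a b)
  let ?c = "Or (sigma2 S b) (WeakUntil (pi1 S a) LFalse)"
  consider "suffix i w \<Turnstile> Until a b" | "\<forall>k. suffix k (suffix i w) \<Turnstile> a"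
    using WeakUntil.prems(2) by auto
  then have "suffix i w \<Turnstile> Until (sigma2 S a) ?c"
  proof cases
    case 1
    then show ?thesis by (rule until_mono) (use WeakUntil.IH WeakUntil.prems(1) in auto)
  next
    case 2
    then have a: "suffix (i + k) w \<Turnstile> a" for k by simp
    have "\<forall>\<^sub>F j in sequentially. suffix j w \<Turnstile> a \<longrightarrow> suffix j w \<Turnstile> pi1 S a"
      using WeakUntil.prems by (intro pi1_complete) auto
    \<comment> \<open>From \<open>n\<close> on, \<open>pi1\<close> loses nothing on
      \<open>a\<close>. The \<open>Until\<close> is discharged at position \<open>i + n\<close>,
      past this threshold, while \<open>sigma2 S a\<close> holds at all positions from
      \<open>i\<close> up to there.\<close>
    then obtain n where n: "\<And>j. j \<ge> n \<Longrightarrow> suffix j w \<Turnstile> a \<Longrightarrow> suffix j w \<Turnstile> pi1 S a"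
      by (auto simp: eventually_sequentially)
    have "suffix (i + (n + l)) w \<Turnstile> pi1 S a" for l by (rule n) (use a in auto)
    then have "suffix n (suffix i w) \<Turnstile> ?c" by (simp add: add.assoc)
    moreover have "suffix j (suffix i w) \<Turnstile> sigma2 S a" for j
      using WeakUntil a by simp
    ultimately show ?thesis unfolding sat.simps(8) by blast
  qed
  then show ?case by simp
qed auto

section \<open>Checking a guess\<close>

text \<open>The check for \<open>Until a b\<close> relies on \<open>sigma1_sound\<close>, whose
  hypothesis exempts \<open>Until\<close> formulas and hence \<open>Until a b\<close> itself; what
  remains lies in \<open>a\<close> and \<open>b\<close> and is covered by induction.
  \<open>WeakUntil\<close> is dual via \<open>pi1_sound\<close>, and the checks for
  \<open>GF\<close> and \<open>FG\<close> relativise only the argument.\<close>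

lemma guess_check_sound:
  assumes "\<forall>t\<in>S. w \<Turnstile> guess_check S t"
  shows "\<forall>t\<in>set (guessable \<phi>) \<inter> S. correct_guess w t"
proof (induction \<phi>)
  case (Until a b)
  have "w \<Turnstile> GF (Until a b)" if "Until a b \<in> S"
  proof -
    have "\<forall>\<^sub>F i in sequentially.
        suffix i w \<Turnstile> sigma1 S (Until a b) \<longrightarrow> suffix i w \<Turnstile> Until a b"
      using Until by (intro sigma1_sound) auto
    moreover have "w \<Turnstile> GF (sigma1 S (Until a b))" using assms that by fastforce
    ultimately show ?thesis unfolding sat_GF_iff by (metis frequently_mp)
  qed
  then show ?case using Until by auto
next
  case (WeakUntil a b)
  have "w \<Turnstile> FG (WeakUntil a b)" if "WeakUntil a b \<in> S"
  proof -
    have "w \<Turnstile> FG (pi1 S (WeakUntil a b))" using assms that by fastforce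
    then show ?thesis unfolding sat_FG_iff
      by (rule eventually_mono) (rule pi1_sound, use WeakUntil in auto)
  qed
  then show ?case using WeakUntil by auto
next
  case (GF a)
  have "w \<Turnstile> GF a" if "GF a \<in> S"
  proof -
    have "\<forall>\<^sub>F i in sequentially. suffix i w \<Turnstile> sigma1 S a \<longrightarrow> suffix i w \<Turnstile> a"
      using GF by (intro sigma1_sound) auto
    moreover have "w \<Turnstile> GF (sigma1 S a)" using assms that by fastforce
    ultimately show ?thesis unfolding sat_GF_iff by (metis frequently_mp)
  qed
  then show ?case using GF by auto
next
  case (FG a)
  have "w \<Turnstile> FG a" if "FG a \<in> S"
  proof -
    have "w \<Turnstile> FG (pi1 S a)" using assms that by fastforce
    then show ?thesis unfolding sat_FG_iff
      by (rule eventually_mono) (rule pi1_sound, use FG in auto)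
  qed
  then show ?case using FG by auto
qed auto

text \<open>\<open>sigma1\<close> loses nothing at any position and \<open>pi1\<close> nothing
  eventually, which suffices under \<open>GF\<close> and under \<open>FG\<close>
  respectively.\<close>

lemma guess_check_complete:
  assumes "\<forall>t\<in>set (guessable \<phi>). correct_guess w t \<longrightarrow> t \<in> S"
  shows "\<forall>t\<in>set (guessable \<phi>). correct_guess w t \<longrightarrow> w \<Turnstile> guess_check S t"
  using assms
proof (induction \<phi>)
  case (Until a b)
  have "w \<Turnstile> GF (sigma1 S (Until a b))" if "w \<Turnstile> GF (Until a b)"
    using that unfolding sat_GF_iff
    by (rule frequently_elim1) (rule sigma1_complete [OF Until.prems])
  then show ?case using Until by auto
next
  case (WeakUntil a b)
  have "w \<Turnstile> FG (pi1 S (WeakUntil a b))" if "w \<Turnstile> FG (WeakUntil a b)"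
    using that pi1_complete [OF WeakUntil.prems] unfolding sat_FG_iff
    by eventually_elim blast
  then show ?case using WeakUntil by auto
next
  case (GF a)
  then have *: "\<forall>t\<in>set (guessable a). correct_guess w t \<longrightarrow> t \<in> S" by simp
  have "w \<Turnstile> GF (sigma1 S a)" if "w \<Turnstile> GF a"
    using that unfolding sat_GF_iff
    by (rule frequently_elim1) (rule sigma1_complete [OF *])
  then show ?case using GF by auto
next
  case (FG a)
  then have *: "\<forall>t\<in>set (guessable a). correct_guess w t \<longrightarrow> t \<in> S" by simp
  have "w \<Turnstile> FG (pi1 S a)" if "w \<Turnstile> FG a"
    using that pi1_complete [OF *] unfolding sat_FG_iff by eventually_elim blast
  then show ?case using FG by auto
qed auto

section \<open>The disjunction over all guesses\<close>

definition guess_disjunct :: "'a ltl \<Rightarrow> 'a ltl list \<Rightarrow> 'a ltl" where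
  "guess_disjunct \<phi> ts = foldr (\<lambda>t. And (guess_check (set ts) t)) ts (sigma2 (set ts) \<phi>)"

definition normal_form_of :: "'a ltl \<Rightarrow> 'a ltl" where
  "normal_form_of \<phi> = foldr (\<lambda>ts. Or (guess_disjunct \<phi> ts)) (subseqs (guessable \<phi>)) LFalse"

lemma sat_foldr_And: "w \<Turnstile> foldr (\<lambda>t. And (f t)) ts \<psi> \<longleftrightarrow> (\<forall>t\<in>set ts. w \<Turnstile> f t) \<and> w \<Turnstile> \<psi>"
  by (induction ts) auto

lemma sat_foldr_Or: "w \<Turnstile> foldr (\<lambda>t. Or (f t)) ts \<psi> \<longleftrightarrow> (\<exists>t\<in>set ts. w \<Turnstile> f t) \<or> w \<Turnstile> \<psi>"
  by (induction ts) auto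

text \<open>The satisfied disjunct may belong to an incomplete guess; its checks still force all
  members to be correct, which is all that soundness asks for.\<close>

lemma sat_normal_form_of: "w \<Turnstile> normal_form_of \<phi> \<longleftrightarrow> w \<Turnstile> \<phi>"
proof
  assume "w \<Turnstile> normal_form_of \<phi>"
  then obtain ts where ts: "\<forall>t\<in>set ts. w \<Turnstile> guess_check (set ts) t" "w \<Turnstile> sigma2 (set ts) \<phi>"
    unfolding normal_form_of_def guess_disjunct_def sat_foldr_Or sat_foldr_And by auto
  then show "w \<Turnstile> \<phi>"
    using sigma2_sound [of \<phi> "set ts" w 0] guess_check_sound [of "set ts" w \<phi>] by simp
next
  assume "w \<Turnstile> \<phi>"
  \<comment> \<open>The exact guess, which meets the hypothesis shared by the completeness
    lemmas.\<close>
  let ?ts = "filter (correct_guess w) (guessable \<phi>)"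
  have S: "\<forall>t\<in>set (guessable \<phi>). correct_guess w t \<longrightarrow> t \<in> set ?ts" by simp
  have "w \<Turnstile> sigma2 (set ?ts) \<phi>"
    using sigma2_complete [OF S, of 0] \<open>w \<Turnstile> \<phi>\<close> by simp
  moreover have "\<forall>t\<in>set ?ts. w \<Turnstile> guess_check (set ?ts) t"
    using guess_check_complete [OF S] by simp
  moreover have "?ts \<in> set (subseqs (guessable \<phi>))"
    by (simp add: subseq_filter_left)
  ultimately show "w \<Turnstile> normal_form_of \<phi>"
    unfolding normal_form_of_def guess_disjunct_def sat_foldr_Or sat_foldr_And by blast
qed

section \<open>Normal form conditions\<close>

lemma free_of_sigma1: "free_of is_WeakUntil (sigma1 S \<phi>)" "free_of is_limit (sigma1 S \<phi>)"
  by (induction \<phi>) auto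

lemma free_of_pi1: "free_of is_Until (pi1 S \<phi>)" "free_of is_limit (pi1 S \<phi>)"
  by (induction \<phi>) auto

lemma free_of_sigma2: "free_of is_limit (sigma2 S \<phi>)"
  by (induction \<phi>) (auto simp: free_of_pi1)

lemma normal_form_And [simp]: "normal_form (And a b) \<longleftrightarrow> normal_form a \<and> normal_form b"
  by (auto simp: normal_form_def)

lemma normal_form_Or [simp]: "normal_form (Or a b) \<longleftrightarrow> normal_form a \<and> normal_form b"
  by (auto simp: normal_form_def)

text \<open>The only \<open>WeakUntil\<close> nodes are those encoding G and those inside
  \<open>pi1\<close>, and no \<open>Until\<close> lies under them. Limit nodes are absent, which
  settles the other conditions.\<close>

lemma normal_form_sigma2: "normal_form (sigma2 S \<phi>)"
proof -
  have "none_under is_Until is_WeakUntil (sigma2 S \<phi>)"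
    by (induction \<phi>) (auto simp: free_of_pi1 free_of_imp_none_under)
  moreover have "none_under P Q (sigma2 S \<phi>)" if "\<And>\<psi>. Q \<psi> \<Longrightarrow> is_limit \<psi>" for P Q
    using free_of_sigma2 [of S \<phi>] that by (auto simp: none_under_def free_of_def)
  ultimately show ?thesis
    unfolding normal_form_def
    by (auto simp: free_of_imp_none_under free_of_sigma2 is_limit_def)
qed

lemma normal_form_guess_check: "normal_form (guess_check S t)"
proof -
  have GF: "normal_form (GF (sigma1 S \<psi>))" for \<psi>
  proof -
    have "none_under P is_WeakUntil (sigma1 S \<psi>)" for P
      using free_of_sigma1 [of S \<psi>] by (auto simp: none_under_def free_of_def)
    moreover have "none_under P is_FG (sigma1 S \<psi>)" for P
      using free_of_sigma1 [of S \<psi>] by (auto simp: none_under_def free_of_def is_limit_def)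
    ultimately show ?thesis
      by (simp add: normal_form_def free_of_sigma1 free_of_imp_none_under)
  qed
  have FG: "normal_form (FG (pi1 S \<psi>))" for \<psi>
  proof -
    have "none_under P is_GF (pi1 S \<psi>)" for P
      using free_of_pi1 [of S \<psi>] by (auto simp: none_under_def free_of_def is_limit_def)
    then show ?thesis
      by (simp add: normal_form_def free_of_pi1 free_of_imp_none_under)
  qed
  have "normal_form LTrue" by (simp add: normal_form_def)
  then show ?thesis by (cases t) (simp_all only: guess_check.simps GF FG)
qed

lemma normal_form_normal_form_of: "normal_form (normal_form_of \<phi>)"
proof -
  have "normal_form (guess_disjunct \<phi> ts)" for ts
  proof -
    \<comment> \<open>The folded list is generalised to \<open>us\<close> while the guess
      \<open>set ts\<close> inside the checks stays fixed.\<close>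
    have "normal_form (foldr (\<lambda>t. And (guess_check (set ts) t)) us (sigma2 (set ts) \<phi>))" for us
      by (induction us) (auto simp: normal_form_sigma2 normal_form_guess_check)
    then show ?thesis unfolding guess_disjunct_def .
  qed
  then have "normal_form (foldr (\<lambda>ts. Or (guess_disjunct \<phi> ts)) tss LFalse)" for tss
    by (induction tss) (auto simp: normal_form_def)
  then show ?thesis unfolding normal_form_of_def .
qed

section \<open>Atomic propositions of the constructed formula\<close>

lemma atoms_guessable: "t \<in> set (guessable \<phi>) \<Longrightarrow> atoms t \<subseteq> atoms \<phi>"
  by (induction \<phi>) auto

lemma atoms_sigma1: "atoms (sigma1 S \<phi>) \<subseteq> atoms \<phi>"
  by (induction \<phi>) auto

lemma atoms_pi1: "atoms (pi1 S \<phi>) \<subseteq> atoms \<phi>"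
  by (induction \<phi>) auto

lemma atoms_sigma2: "atoms (sigma2 S \<phi>) \<subseteq> atoms \<phi>"
  using atoms_pi1 by (induction \<phi>) fastforce+

lemma atoms_guess_check: "atoms (guess_check S t) \<subseteq> atoms t"
proof (cases t)
  case (Until a b)
  then show ?thesis using atoms_sigma1 [of S t] by simp
next
  case (WeakUntil a b)
  then show ?thesis using atoms_pi1 [of S t] by simp
qed (simp_all add: atoms_sigma1 atoms_pi1)

lemma atoms_normal_form_of: "atoms (normal_form_of \<phi>) \<subseteq> atoms \<phi>"
proof -
  have "atoms (guess_disjunct \<phi> ts) \<subseteq> atoms \<phi>" if "set ts \<subseteq> set (guessable \<phi>)" for ts
  proof -
    have "set us \<subseteq> set (guessable \<phi>) \<Longrightarrow>
        atoms (foldr (\<lambda>t. And (guess_check (set ts) t)) us (sigma2 (set ts) \<phi>)) \<subseteq> atoms \<phi>" for us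
    proof (induction us)
      case Nil
      then show ?case by (simp add: atoms_sigma2)
    next
      case (Cons u us)
      then have "atoms (guess_check (set ts) u) \<subseteq> atoms \<phi>"
        using atoms_guess_check atoms_guessable by fastforce
      then show ?case using Cons by simp
    qed
    then show ?thesis unfolding guess_disjunct_def using that .
  qed
  moreover have "set ts \<subseteq> set (guessable \<phi>)" if "ts \<in> set (subseqs (guessable \<phi>))" for ts
    using that subseqs_powset by (metis Pow_iff image_eqI)
  ultimately have *: "\<forall>ts\<in>set (subseqs (guessable \<phi>)). atoms (guess_disjunct \<phi> ts) \<subseteq> atoms \<phi>"
    by blast
  have "\<forall>ts\<in>set tss. atoms (guess_disjunct \<phi> ts) \<subseteq> atoms \<phi> \<Longrightarrow>
      atoms (foldr (\<lambda>ts. Or (guess_disjunct \<phi> ts)) tss LFalse) \<subseteq> atoms \<phi>" for tss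
    by (induction tss) auto
  with * show ?thesis unfolding normal_form_of_def by blast
qed

section \<open>Size\<close>

lemma length_guessable: "length (guessable \<phi>) \<le> num_nodes \<phi>"
  by (induction \<phi>) auto

lemma num_nodes_guessable: "t \<in> set (guessable \<phi>) \<Longrightarrow> num_nodes t \<le> num_nodes \<phi>"
  by (induction \<phi>) auto

lemma num_nodes_sigma1: "num_nodes (sigma1 S \<phi>) \<le> num_nodes \<phi>"
  by (induction \<phi>) auto

lemma num_nodes_pi1: "num_nodes (pi1 S \<phi>) \<le> num_nodes \<phi>"
  by (induction \<phi>) auto

lemma num_nodes_guess_check: "num_nodes (guess_check S t) \<le> num_nodes t + 1"
proof (cases t)
  case (Until a b)
  then show ?thesis using num_nodes_sigma1 [of S t] by simp
next
  case (WeakUntil a b)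
  then show ?thesis using num_nodes_pi1 [of S t] by simp
qed (simp_all add: num_nodes_sigma1 num_nodes_pi1 le_SucI)

text \<open>Each \<open>WeakUntil\<close> duplicates its left argument through \<open>pi1\<close>,
  so nesting on the left can add up to quadratic size.\<close>

lemma num_nodes_sigma2: "num_nodes (sigma2 S \<phi>) \<le> 2 * (num_nodes \<phi>)\<^sup>2"
proof (induction \<phi>)
  case (WeakUntil a b)
  \<comment> \<open>The cross term 4|a||b| of the doubled square pays for the four nodes
    \<open>Until\<close>, \<open>Or\<close>, \<open>WeakUntil\<close> and
    \<open>LFalse\<close>.\<close>
  have "4 * 1 \<le> 4 * (num_nodes a * num_nodes b)"
    using num_nodes_pos [of a] num_nodes_pos [of b] by (intro mult_left_mono) auto
  then show ?case
    using WeakUntil num_nodes_pi1 [of S a] num_nodes_pos [of a] num_nodes_pos [of b]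
    by (simp add: power2_eq_square algebra_simps)
qed (auto simp: power2_eq_square algebra_simps)

text \<open>With n nodes in \<open>\<phi>\<close>, each of the at most n checks has at most n + 1
  nodes, plus one for \<open>And\<close>; n(n + 2) + 2n^2 is at most 5n^2.\<close>

lemma num_nodes_guess_disjunct:
  assumes "ts \<in> set (subseqs (guessable \<phi>))"
  shows "num_nodes (guess_disjunct \<phi> ts) \<le> 5 * (num_nodes \<phi>)\<^sup>2"
proof -
  let ?n = "num_nodes \<phi>"
  have "set us \<subseteq> set (guessable \<phi>) \<Longrightarrow>
      num_nodes (foldr (\<lambda>t. And (guess_check (set ts) t)) us (sigma2 (set ts) \<phi>))
        \<le> length us * (?n + 2) + 2 * ?n\<^sup>2" for us
  proof (induction us)
    case Nil
    then show ?case by (simp add: num_nodes_sigma2)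
  next
    case (Cons u us)
    then have "num_nodes (guess_check (set ts) u) \<le> ?n + 1"
      using num_nodes_guess_check [of "set ts" u] num_nodes_guessable [of u \<phi>] by simp
    then show ?case using Cons by simp
  qed
  moreover have "set ts \<subseteq> set (guessable \<phi>)"
    using assms subseqs_powset by (metis Pow_iff image_eqI)
  ultimately have "num_nodes (guess_disjunct \<phi> ts) \<le> length ts * (?n + 2) + 2 * ?n\<^sup>2"
    unfolding guess_disjunct_def by blast
  moreover have "length ts \<le> ?n"
    using assms length_guessable [of \<phi>] by (auto dest: list_emb_length)
  then have "length ts * (?n + 2) \<le> ?n * (?n + 2)" by (rule mult_right_mono) simp
  moreover have "?n \<le> ?n * ?n" by simp
  ultimately show ?thesis unfolding power2_eq_square add_mult_distrib2 by linarith
qed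

text \<open>There are at most 2^n disjuncts, each of size at most 5n^2 plus its \<open>Or\<close>.
  The crude estimates pass through 1024^n = 4^(5n).\<close>

lemma num_nodes_normal_form_of: "num_nodes (normal_form_of \<phi>) \<le> 4 ^ (7 * num_nodes \<phi>)"
proof -
  let ?n = "num_nodes \<phi>"
  have n: "?n \<ge> 1" by (rule num_nodes_pos)
  have "\<forall>ts\<in>set tss. num_nodes (guess_disjunct \<phi> ts) \<le> 5 * ?n\<^sup>2 \<Longrightarrow>
      num_nodes (foldr (\<lambda>ts. Or (guess_disjunct \<phi> ts)) tss LFalse)
        \<le> length tss * (5 * ?n\<^sup>2 + 1) + 1" for tss
    by (induction tss) auto
  from this [of "subseqs (guessable \<phi>)"]
  have "num_nodes (normal_form_of \<phi>) \<le> 2 ^ length (guessable \<phi>) * (5 * ?n\<^sup>2 + 1) + 1"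
    unfolding normal_form_of_def length_subseqs using num_nodes_guess_disjunct by blast
  \<comment> \<open>The closing \<open>LFalse\<close> is charged as 2^n, so that this factor can be
    pulled out.\<close>
  also have "\<dots> \<le> 2 ^ ?n * (5 * ?n\<^sup>2 + 1) + 2 ^ ?n * 1"
    using length_guessable [of \<phi>] by (intro add_mono mult_right_mono power_increasing) auto
  also have "\<dots> = 2 ^ ?n * (5 * ?n\<^sup>2 + 2)" by (simp only: flip: distrib_left) simp
  also have "\<dots> \<le> 4 ^ ?n * (16 ^ ?n * 16 ^ ?n)"
  proof (rule mult_mono)
    \<comment> \<open>Since n <= 2^n <= 4^n, n^2 is at most 16^n; hence 5n^2 + 2 is at most 7 *
      16^n, below 16 * 16^n.\<close>
    have "?n\<^sup>2 \<le> (4 ^ ?n)\<^sup>2"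
      by (rule power_mono) (use less_exp [of ?n] power_mono [of 2 "4::nat" ?n] in linarith, simp)
    also have "\<dots> = 16 ^ ?n" by (simp add: power2_eq_square flip: power_mult_distrib)
    finally have "?n\<^sup>2 \<le> 16 ^ ?n" .
    moreover have "16 * 1 \<le> (16::nat) ^ ?n" using self_le_power [of "16::nat" ?n] n by simp
    then have "16 * 16 ^ ?n \<le> (16::nat) ^ ?n * 16 ^ ?n" by (intro mult_right_mono) simp_all
    moreover have "1 \<le> (16::nat) ^ ?n" by simp
    ultimately show "5 * ?n\<^sup>2 + 2 \<le> 16 ^ ?n * 16 ^ ?n" by linarith
  qed (auto intro: power_mono)
  also have "\<dots> = (4 * (16 * 16)) ^ ?n" by (simp only: power_mult_distrib)
  also have "\<dots> \<le> (4 ^ 7) ^ ?n" by (rule power_mono) simp_all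
  finally show ?thesis by (simp only: power_mult)
qed

theorem theorem5p12:
  fixes Ap :: "'a set" and \<phi> :: "'a ltl"
  assumes "finite Ap" and "atoms \<phi> \<subseteq> Ap"
  shows "\<exists>\<psi>. atoms \<psi> \<subseteq> Ap \<and> equivalent Ap \<phi> \<psi> \<and> normal_form \<psi> \<and>
           num_nodes \<psi> \<le> 4 ^ (7 * num_nodes \<phi>)"
proof (rule exI [of _ "normal_form_of \<phi>"], intro conjI)
  show "atoms (normal_form_of \<phi>) \<subseteq> Ap" using atoms_normal_form_of assms(2) by (rule subset_trans)
  show "equivalent Ap \<phi> (normal_form_of \<phi>)" by (simp add: equivalent_def sat_normal_form_of)
  show "normal_form (normal_form_of \<phi>)" by (rule normal_form_normal_form_of)
  show "num_nodes (normal_form_of \<phi>) \<le> 4 ^ (7 * num_nodes \<phi>)"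
    by (rule num_nodes_normal_form_of)
qed

end
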